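(* Let $i\in\mathcal H$ be any benign agent. Suppose that in $IOS(\cdot)$ agent $i$ discards $b_i$ messages and in $ARC(\cdot)$ it clips $b_i$ messages. Then the robust aggregation rule $IOS(ARC(\cdot))$ satisfies $$\|IOS(ARC(\lambda_i,\{\check\lambda_j\}_{j\in\mathcal N_i}))\|\le\max_{j\in(\mathcal N_i\cap\mathcal H)\cup\{i\}}\|\lambda_j\|$$ for all messages $\lambda_i,\{\check\lambda_j\}_{j\in\mathcal N_i}$ in $\mathbb R^d$.
   Context: Setting: $\mathcal M$ is a set of $M$ agents, the disjoint union of benign agents $\mathcal H$ and Byzantine agents $\mathcal B$, connected by an undirected connected graph $\widetilde{\mathcal G}=(\mathcal M,\widetilde{\mathcal E})$; $\mathcal N_i$ is the set of neighbors of $i$. $\widetilde E=[\widetilde e_{ij}]\in\mathbb R^{M\times M}$ is doubly stochastic, with $\widetilde e_{ij}>0$ if and only if $(i,j)\in\widetilde{\mathcal E}$ or $i=j$. Each benign agent $i$ holds $\lambda_i\in\mathbb R^d$ and receives messages $\check\lambda_j\in\mathbb R^d$, $j\in\mathcal N_i$, with $\check\lambda_j=\lambda_j$ if $j\in\mathcal H$ and $\check\lambda_j$ arbitrary if $j\in\mathcal B$. Throughout, $b_i$ is an upper bound on the number of Byzantine neighbors, $|\mathcal N_i\cap\mathcal B|\le b_i$, with $b_i+1\le|\mathcal N_i|$ so that $ARC$ is well defined. $ARC$: $clip_C(x):=\min(1,C/\|x\|)\,x$ (and $clip_C(0)=0$); let $C_i$ be the $(b_i+1)$-th largest among the norms $\|\check\lambda_j\|$,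 $j\in\mathcal N_i$; then $ARC(\lambda_i,\{\check\lambda_j\}_{j\in\mathcal N_i})=\{\lambda_i,\{clip_{C_i}(\check\lambda_j)\}_{j\in\mathcal N_i}\}$ (own vector not clipped). $IOS$ applied to $\{x_i,\{x_j\}_{j\in\mathcal N_i}\}$: start from $U=\mathcal N_i\cup\{i\}$; repeat $b_i$ times: compute the weighted average $\frac{\sum_{j\in U}\widetilde e_{ij}x_j}{\sum_{j\in U}\widetilde e_{ij}}$ and remove from $U$ the neighbor $j\in U\setminus\{i\}$ whose $x_j$ is farthest from it (own vector $x_i$ is never removed). With $U_i$ the final set, the output is $\frac{\sum_{j\in U_i}\widetilde e_{ij}x_j}{\sum_{j\in U_i}\widetilde e_{ij}}$. $IOS(ARC(\cdot))$ is the composition. *)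

theory Defs
  imports "HOL-Analysis.Analysis" "HOL-Library.Multiset" "Graph_Theory.Pair_Digraph"
    "Graph_Theory.Digraph_Component"
begin

definition neighbors :: "'a pair_pre_digraph \<Rightarrow> 'a \<Rightarrow> 'a set" where
  "neighbors G i = {j. (i, j) \<in> parcs G}"

definition doubly_stochastic_on :: "'a set \<Rightarrow> ('a \<Rightarrow> 'a \<Rightarrow> real) \<Rightarrow> bool" where
  "doubly_stochastic_on V E \<longleftrightarrow>
     (\<forall>i\<in>V. \<forall>j\<in>V. 0 \<le> E i j) \<and>
     (\<forall>i\<in>V. (\<Sum>j\<in>V. E i j) = 1) \<and>
     (\<forall>j\<in>V. (\<Sum>i\<in>V. E i j) = 1)"

(* At x = 0 this gives 0, as required, because C / 0 = 0. *)
definition clip :: "real \<Rightarrow> 'v::real_normed_vector \<Rightarrow> 'v" where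
  "clip C x = min 1 (C / norm x) *\<^sub>R x"

(* The k-th largest value (k = 1, 2, ...) of the family (f j) with j in A, counted with
   multiplicity; meaningful for finite A and 1 \<le> k \<le> card A. *)
definition kth_largest :: "nat \<Rightarrow> 'a set \<Rightarrow> ('a \<Rightarrow> real) \<Rightarrow> real" where
  "kth_largest k A f = rev (sorted_list_of_multiset (image_mset f (mset_set A))) ! (k - 1)"

(* A collection {x_i, {x_j}_{j in N}} is represented by the pair of the own vector x_i and the
   function j \<mapsto> x_j; only the values of this function on N matter. *)
definition ARC :: "nat \<Rightarrow> 'a set \<Rightarrow> 'v::real_normed_vector \<times> ('a \<Rightarrow> 'v) \<Rightarrow> 'v \<times> ('a \<Rightarrow> 'v)" where
  "ARC b N = (\<lambda>(own, msg). (own, \<lambda>j. clip (kth_largest (b + 1) N (\<lambda>k. norm (msg k))) (msg j)))"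

definition weighted_average :: "('a \<Rightarrow> real) \<Rightarrow> ('a \<Rightarrow> 'v::real_normed_vector) \<Rightarrow> 'a set \<Rightarrow> 'v" where
  "weighted_average e x U = (\<Sum>j\<in>U. e j *\<^sub>R x j) /\<^sub>R (\<Sum>j\<in>U. e j)"

definition farthest :: "('a \<Rightarrow> real) \<Rightarrow> 'a \<Rightarrow> ('a \<Rightarrow> 'v::real_normed_vector) \<Rightarrow> 'a set \<Rightarrow> 'a set" where
  "farthest e i x U =
     {j. is_arg_max (\<lambda>k. dist (x k) (weighted_average e x U)) (\<lambda>k. k \<in> U - {i}) j}"

(* Several neighbors can be equally far; tb chooses one of them. *)
definition discard_farthest ::
  "('a set \<Rightarrow> 'a) \<Rightarrow> ('a \<Rightarrow> real) \<Rightarrow> 'a \<Rightarrow> ('a \<Rightarrow> 'v::real_normed_vector) \<Rightarrow> 'a set \<Rightarrow> 'a set" where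
  "discard_farthest tb e i x U = U - {tb (farthest e i x U)}"

(* A tie breaker returns an element of every nonempty set of tied candidates. Candidate sets of
   different rounds of one run are distinct (an earlier one contains a neighbor that has been
   discarded since), so every way of resolving the ties in a run is given by some tie breaker. *)
definition tie_breaker :: "('a set \<Rightarrow> 'a) \<Rightarrow> bool" where
  "tie_breaker tb \<longleftrightarrow> (\<forall>S. S \<noteq> {} \<longrightarrow> tb S \<in> S)"

(* The weights e are row i of the matrix. *)
definition IOS ::
  "('a set \<Rightarrow> 'a) \<Rightarrow> ('a \<Rightarrow> real) \<Rightarrow> 'a \<Rightarrow> nat \<Rightarrow> 'a set \<Rightarrow>
     'v::real_normed_vector \<times> ('a \<Rightarrow> 'v) \<Rightarrow> 'v" where
  "IOS tb e i b N = (\<lambda>(own, msg).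
     let x = msg(i := own)
     in weighted_average e x ((discard_farthest tb e i x ^^ b) (N \<union> {i})))"

end

theory Submission
  imports Defs
begin

text \<open>
  The output of \<^const>\<open>IOS\<close> is a weighted average, with nonnegative weights, of the own vector and
  of those clipped messages that survive the discarding. As norm balls are convex, it suffices to
  bound the norm of each of these vectors. The own vector is among those on the right-hand side,
  and a clipped message has norm at most the clipping threshold. So everything rests on the
  threshold not exceeding the norm of some benign neighbor's message
  (\<open>kth_largest_le_remaining\<close>): the threshold is the \<open>(b + 1)\<close>-th largest of the norms, hence at
  least \<open>b + 1\<close> neighbors send a message whose norm reaches it, and since at most \<open>b\<close> of these
  neighbors are Byzantine, one of them is benign.
\<close>

lemma kth_largest_in_image:
  assumes "finite A" "1 \<le> k" "k \<le> card A"
  shows "kth_largest k A f \<in> f ` A"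
proof -
  let ?xs = "rev (sorted_list_of_multiset (image_mset f (mset_set A)))"
  have "length ?xs = card A"
    by (metis length_rev mset_sorted_list_of_multiset size_image_mset size_mset size_mset_set)
  then have "kth_largest k A f \<in> set ?xs"
    unfolding kth_largest_def using assms by (intro nth_mem) simp
  also have "set ?xs = f ` A"
    using assms by simp
  finally show ?thesis .
qed

text \<open>
  Equality can fail only because of ties: in the list of values sorted in decreasing order, the
  first \<open>k\<close> entries are at least the \<open>k\<close>-th one.
\<close>
lemma card_ge_kth_largest:
  assumes "finite A" "1 \<le> k" "k \<le> card A"
  shows "k \<le> card {j \<in> A. kth_largest k A f \<le> f j}"
proof -
  define xs where "xs = rev (sorted_list_of_multiset (image_mset f (mset_set A)))"
  define c where "c = kth_largest k A f"
  have c: "c = xs ! (k - 1)"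
    by (simp add: c_def xs_def kth_largest_def)
  have mset: "mset xs = image_mset f (mset_set A)"
    by (simp add: xs_def)
  then have len: "length xs = card A"
    by (metis size_image_mset size_mset size_mset_set)
  have "sorted (rev xs)"
    by (simp add: xs_def)
  then have "c \<le> xs ! n" if "n < k" for n
    unfolding c using that assms len by (intro sorted_rev_nth_mono) auto
  then have "{..<k} \<subseteq> {n. n < length xs \<and> c \<le> xs ! n}"
    using assms len by auto
  then have "k \<le> card {n. n < length xs \<and> c \<le> xs ! n}"
    using card_mono[of "{n. n < length xs \<and> c \<le> xs ! n}" "{..<k}"] by simp
  also have "\<dots> = size (filter_mset ((\<le>) c) (mset xs))"
    by (simp add: length_filter_conv_card flip: mset_filter)
  also have "\<dots> = card {j \<in> A. c \<le> f j}"
    using assms by (simp add: mset filter_mset_image_mset)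
  finally show ?thesis
    by (simp add: c_def)
qed

text \<open>
  The pigeonhole step: fewer than \<open>k\<close> removed elements cannot include all the elements, at least
  \<open>k\<close> in number, whose value reaches the \<open>k\<close>-th largest.
\<close>
lemma kth_largest_le_remaining:
  assumes "finite A" "1 \<le> k" "k \<le> card A" and few: "card (A \<inter> R) < k"
  obtains j where "j \<in> A - R" "kth_largest k A f \<le> f j"
proof -
  have "\<not> {j \<in> A. kth_largest k A f \<le> f j} \<subseteq> A \<inter> R"
  proof
    assume "{j \<in> A. kth_largest k A f \<le> f j} \<subseteq> A \<inter> R"
    then have "card {j \<in> A. kth_largest k A f \<le> f j} \<le> card (A \<inter> R)"
      using assms(1) by (intro card_mono) auto
    with few card_ge_kth_largest[OF assms(1-3), of f] show False
      by linarith
  qed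
  then show thesis
    using that by blast
qed

lemma norm_clip_le:
  assumes "0 \<le> C"
  shows "norm (clip C x) \<le> C"
proof (cases "x = 0")
  case False
  have "norm (clip C x) = min 1 (C / norm x) * norm x"
    using assms by (simp add: clip_def)
  also have "\<dots> \<le> C / norm x * norm x"
    by (intro mult_right_mono) auto
  finally show ?thesis
    using False by simp
qed (use assms in \<open>simp add: clip_def\<close>)

text \<open>
  This is convexity of the ball of radius \<open>M\<close>, except that total weight zero is allowed: the
  average is then the zero vector, which is why \<open>M\<close> has to be nonnegative.
\<close>
lemma norm_weighted_average_le:
  assumes "\<And>j. j \<in> U \<Longrightarrow> 0 \<le> e j" "\<And>j. j \<in> U \<Longrightarrow> norm (x j) \<le> M" "0 \<le> M"
  shows "norm (weighted_average e x U) \<le> M"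
proof -
  have nonneg: "0 \<le> sum e U"
    using assms(1) by (rule sum_nonneg)
  have "norm (\<Sum>j\<in>U. e j *\<^sub>R x j) \<le> (\<Sum>j\<in>U. e j * M)"
    using assms by (intro sum_norm_le) (simp add: mult_left_mono)
  also have "\<dots> = M * sum e U"
    by (simp add: sum_distrib_left mult.commute)
  finally show ?thesis
    using nonneg assms(3)
    by (cases "sum e U = 0") (simp_all add: weighted_average_def field_simps)
qed

lemma discard_farthest_iterate_subset: "(discard_farthest tb e i x ^^ n) U \<subseteq> U"
  by (induction n) (auto simp: discard_farthest_def)

theorem lemma13:
  fixes G :: "'a pair_pre_digraph"
    and H B :: "'a set"
    and E :: "'a \<Rightarrow> 'a \<Rightarrow> real"
    and b :: "'a \<Rightarrow> nat"
    and tb :: "'a set \<Rightarrow> 'a"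
    and i :: 'a
    and lam msg :: "'a \<Rightarrow> real ^ 'd"
  assumes "pair_graph G"
    and "Digraph_Component.connected (with_proj G)"
    and "pverts G = H \<union> B" and "H \<inter> B = {}"
    and "doubly_stochastic_on (pverts G) E"
    and "\<forall>k\<in>pverts G. \<forall>j\<in>pverts G. 0 < E k j \<longleftrightarrow> (k, j) \<in> parcs G \<or> k = j"
    and "tie_breaker tb"
    and "i \<in> H"
    and "card (neighbors G i \<inter> B) \<le> b i"
    and "b i + 1 \<le> card (neighbors G i)"
    and "\<forall>j\<in>neighbors G i \<inter> H. msg j = lam j"
  shows "norm (IOS tb (E i) i (b i) (neighbors G i) (ARC (b i) (neighbors G i) (lam i, msg)))
           \<le> (MAX j\<in>(neighbors G i \<inter> H) \<union> {i}. norm (lam j))"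
proof -
  define N where "N = neighbors G i"
  define C where "C = kth_largest (b i + 1) N (\<lambda>k. norm (msg k))"
  define M where "M = (MAX j\<in>(N \<inter> H) \<union> {i}. norm (lam j))"
  define x where "x = (\<lambda>j. clip C (msg j))(i := lam i)"

  interpret pair_graph G by fact
  have N_subset: "N \<subseteq> pverts G"
    unfolding N_def neighbors_def by (auto dest: in_arcsD2)
  then have N_finite: "finite N"
    using finite_subset pair_finite_verts by blast
  have M_upper: "norm (lam j) \<le> M" if "j \<in> (N \<inter> H) \<union> {i}" for j
    unfolding M_def using N_finite that by (intro Max_ge) auto
  have M_nonneg: "0 \<le> M"
    using order_trans[OF norm_ge_zero M_upper[of i]] by simp

  have k: "1 \<le> b i + 1" "b i + 1 \<le> card N" and few: "card (N \<inter> B) < b i + 1"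
    using assms(9,10) by (simp_all add: N_def)
  have C_nonneg: "0 \<le> C"
    using kth_largest_in_image[OF N_finite k, of "\<lambda>k. norm (msg k)"] by (auto simp: C_def)
  obtain j where j: "j \<in> N - B" "C \<le> norm (msg j)"
    using kth_largest_le_remaining[OF N_finite k few, of "\<lambda>k. norm (msg k)"]
    unfolding C_def .
  then have "j \<in> N \<inter> H"
    using N_subset assms(3) by blast
  then have "C \<le> M"
    using j(2) assms(11) M_upper[of j] by (auto simp: N_def)

  then have x_le: "norm (x j) \<le> M" for j
    using norm_clip_le[OF C_nonneg, of "msg j"] M_upper[of i] by (simp add: x_def)
  have E_nonneg: "0 \<le> E i j" if "j \<in> N \<union> {i}" for j
    using assms(3,5,8) N_subset that unfolding doubly_stochastic_on_def by blast

  have "norm (weighted_average (E i) x ((discard_farthest tb (E i) i x ^^ b i) (N \<union> {i}))) \<le> M"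
    using x_le M_nonneg E_nonneg[OF subsetD[OF discard_farthest_iterate_subset]]
    by (intro norm_weighted_average_le)
  then show ?thesis
    by (simp add: IOS_def ARC_def x_def C_def M_def N_def Let_def)
qed

end
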